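(* There is a function $g(d)=O(\log^4(d+1)\,\log\log(d+1))$ such that for every integer $n$ and all $d=d(n)$, $d'=d'(n)$ with $d\le 2^{n/4}$ and $g(d)<d'<d/8-1$: (i) $\mathsf{NOBDD^{\lfloor\log d\rfloor}}\subsetneq\mathsf{OBDD^{d}}$; and (ii) $\mathsf{OBDD^{d}}$ and $\mathsf{NOBDD^{d'}}$ are incomparable, i.e. neither is contained in the other.
   Context: $\log$ is base $2$. $\mathsf{OBDD^d}$ (resp. $\mathsf{NOBDD^d}$) denotes the set of Boolean functions $f:\{0,1\}^n\to\{0,1\}$ computable by a deterministic (resp. nondeterministic) OBDD of width $d$ (at most $d$ nodes per level), $n$ being the number of variables. A deterministic OBDD on $x_1,\dots,x_n$ with order $\pi$ (a permutation of $\{1,\dots,n\}$) is a leveled directed acyclic graph with levels $0,\dots,n$, a single source at level $0$, every node at level $j-1$ having exactly one outgoing edge labelled $0$ and one labelled $1$ to nodes at level $j$, and nodes at level $n$ marked accepting or rejecting; on input $\nu$ one follows from the source at step $j$ the edge labelled $\nu_{\pi(j)}$ and outputs $1$ iff an accepting node is reached. A nondeterministic OBDD allows any number of outgoing edges with each label and outputs $1$ iff some consistent path reaches an accepting node. Width is the maximum number of nodes in a level. *)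

theory Defs
  imports
    Complex_Main
    "HOL-Library.FuncSet"
    "HOL-Library.Disjoint_Sets"
    "HOL-Library.Landau_Symbols"
    "HOL-Combinatorics.Permutations"
begin

definition inputs :: "nat \<Rightarrow> (nat \<Rightarrow> bool) set" where
  "inputs n = {1..n} \<rightarrow>\<^sub>E UNIV"

text \<open>Extensionality makes set inclusion between classes of Boolean functions
  depend only on the values on \<open>{0,1}\<^sup>n\<close>.\<close>

definition boolean_functions :: "nat \<Rightarrow> ((nat \<Rightarrow> bool) \<Rightarrow> bool) set" where
  "boolean_functions n = inputs n \<rightarrow>\<^sub>E UNIV"

text \<open>An edge \<open>(u, b, v)\<close> goes from \<open>u\<close> to \<open>v\<close> and is labelled \<open>b\<close>; nodes of the
  last level outside \<open>accepting\<close> are rejecting.\<close>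

record 'v bdd =
  level :: "nat \<Rightarrow> 'v set"
  source :: 'v
  edges :: "('v \<times> bool \<times> 'v) set"
  var_order :: "nat \<Rightarrow> nat"
  accepting :: "'v set"

definition nondeterministic_obdd :: "nat \<Rightarrow> 'v bdd \<Rightarrow> bool" where
  "nondeterministic_obdd n B \<longleftrightarrow>
     var_order B permutes {1..n} \<and>
     (\<forall>j\<in>{0..n}. finite (level B j)) \<and>
     disjoint_family_on (level B) {0..n} \<and>
     level B 0 = {source B} \<and>
     edges B \<subseteq> (\<Union>j\<in>{1..n}. level B (j - 1) \<times> UNIV \<times> level B j) \<and>
     accepting B \<subseteq> level B n"

definition deterministic_obdd :: "nat \<Rightarrow> 'v bdd \<Rightarrow> bool" where
  "deterministic_obdd n B \<longleftrightarrow>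
     nondeterministic_obdd n B \<and>
     (\<forall>j\<in>{1..n}. \<forall>u\<in>level B (j - 1). \<forall>b. \<exists>!v. (u, b, v) \<in> edges B)"

definition consistent_path :: "nat \<Rightarrow> 'v bdd \<Rightarrow> (nat \<Rightarrow> bool) \<Rightarrow> (nat \<Rightarrow> 'v) \<Rightarrow> bool" where
  "consistent_path n B \<nu> p \<longleftrightarrow>
     p \<in> extensional {0..n} \<and> p 0 = source B \<and>
     (\<forall>j\<in>{1..n}. (p (j - 1), \<nu> (var_order B j), p j) \<in> edges B)"

definition obdd_output :: "nat \<Rightarrow> 'v bdd \<Rightarrow> (nat \<Rightarrow> bool) \<Rightarrow> bool" where
  "obdd_output n B \<nu> \<longleftrightarrow> (\<exists>p. consistent_path n B \<nu> p \<and> p n \<in> accepting B)"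

definition width :: "nat \<Rightarrow> 'v bdd \<Rightarrow> nat" where
  "width n B = Max ((\<lambda>j. card (level B j)) ` {0..n})"

definition computes :: "nat \<Rightarrow> 'v bdd \<Rightarrow> ((nat \<Rightarrow> bool) \<Rightarrow> bool) \<Rightarrow> bool" where
  "computes n B f \<longleftrightarrow> (\<forall>\<nu>\<in>inputs n. f \<nu> \<longleftrightarrow> obdd_output n B \<nu>)"

text \<open>Only finitely many nodes occur, so taking natural numbers as nodes loses no generality.\<close>

definition NOBDD :: "nat \<Rightarrow> nat \<Rightarrow> ((nat \<Rightarrow> bool) \<Rightarrow> bool) set" where
  "NOBDD n d = {f \<in> boolean_functions n.
     \<exists>B :: nat bdd. nondeterministic_obdd n B \<and> width n B \<le> d \<and> computes n B f}"

definition OBDD :: "nat \<Rightarrow> nat \<Rightarrow> ((nat \<Rightarrow> bool) \<Rightarrow> bool) set" where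
  "OBDD n d = {f \<in> boolean_functions n.
     \<exists>B :: nat bdd. deterministic_obdd n B \<and> width n B \<le> d \<and> computes n B f}"

text \<open>In a deterministic OBDD the path followed on an input is the unique consistent path,
  so \<^const>\<open>obdd_output\<close> is also the output of the deterministic computation.\<close>

lemma deterministic_obdd_unique_path:
  assumes "deterministic_obdd n B"
  shows "\<exists>!p. consistent_path n B \<nu> p"
proof -
  have ex1: "\<exists>!v. (u, b, v) \<in> edges B" if "j < n" "u \<in> level B j" for j u b
  proof -
    have "\<forall>u\<in>level B (Suc j - 1). \<forall>b. \<exists>!v. (u, b, v) \<in> edges B"
      using assms that(1) unfolding deterministic_obdd_def
      by (elim conjE) (erule bspec, simp)
    with that(2) show ?thesis by simp
  qed
  have dis: "disjoint_family_on (level B) {0..n}"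
    and sub: "edges B \<subseteq> (\<Union>j\<in>{1..n}. level B (j - 1) \<times> UNIV \<times> level B j)"
    and l0: "level B 0 = {source B}"
    using assms unfolding deterministic_obdd_def nondeterministic_obdd_def by simp_all
  have step: "v \<in> level B (Suc j)" if h: "j < n" "u \<in> level B j" "(u, b, v) \<in> edges B" for j u b v
  proof -
    obtain i where i: "i \<in> {1..n}" "u \<in> level B (i - 1)" "v \<in> level B i"
      using subsetD[OF sub h(3)] by auto
    have "i - 1 = j"
    proof (rule ccontr)
      assume "i - 1 \<noteq> j"
      then have "level B (i - 1) \<inter> level B j = {}"
        using dis i(1) h(1) by (intro disjoint_family_onD[OF dis]) auto
      with i(2) h(2) show False by blast
    qed
    with i show ?thesis by auto
  qed
  define q where "q = rec_nat (source B) (\<lambda>j u. THE v. (u, \<nu> (var_order B (Suc j)), v) \<in> edges B)"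
  have q0: "q 0 = source B"
    and qS: "q (Suc j) = (THE v. (q j, \<nu> (var_order B (Suc j)), v) \<in> edges B)" for j
    by (simp_all add: q_def)
  have lev: "q j \<in> level B j" if "j \<le> n" for j
    using that
  proof (induction j)
    case (Suc j)
    then have "(q j, \<nu> (var_order B (Suc j)), q (Suc j)) \<in> edges B"
      unfolding qS using theI'[OF ex1[of j "q j"]] by simp
    with Suc step show ?case by simp
  qed (simp add: q0 l0)
  have edge: "(q j, \<nu> (var_order B (Suc j)), q (Suc j)) \<in> edges B" if "j < n" for j
    unfolding qS using theI'[OF ex1[OF that lev]] that by simp
  show ?thesis
  proof (rule ex1I)
    show "consistent_path n B \<nu> (restrict q {0..n})"
      unfolding consistent_path_def
    proof (intro conjI ballI)
      fix j assume "j \<in> {1..n}"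
      then show "(restrict q {0..n} (j - 1), \<nu> (var_order B j), restrict q {0..n} j) \<in> edges B"
        using edge[of "j - 1"] by auto
    qed (simp_all add: q0)
  next
    fix p assume p: "consistent_path n B \<nu> p"
    have "p j = q j" if "j \<le> n" for j
      using that
    proof (induction j)
      case (Suc j)
      have "(p j, \<nu> (var_order B (Suc j)), p (Suc j)) \<in> edges B"
        using p Suc.prems unfolding consistent_path_def
        by (elim conjE) (drule bspec[of _ _ "Suc j"], simp_all)
      then have "(q j, \<nu> (var_order B (Suc j)), p (Suc j)) \<in> edges B"
        using Suc by simp
      then show ?case
        using Suc.prems ex1[of j "q j" "\<nu> (var_order B (Suc j))"] lev[of j] edge[of j]
        by (metis Suc_le_lessD less_imp_le_nat)
    qed (use p in \<open>simp add: q0 consistent_path_def\<close>)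
    with p show "p = restrict q {0..n}"
      by (intro extensionalityI[of _ "{0..n}"]) (auto simp: consistent_path_def)
  qed
qed

end

theory Submission
  imports Defs "HOL-Library.Nat_Bijection"
begin

text \<open>
  Both separating functions read the variables in pairs of a control bit and a value bit. Whatever
  the variable order is, one cuts it where the desired number of value bits has been read, and then
  chooses the control bits so that the values read and the values still unread play different roles.

  For \<open>OBDD\<^sup>d \<not>\<subseteq> NOBDD\<^sup>d\<^sup>'\<close>, the control bit says whether the value is appended to a queue or
  compared with its head. A queue of capacity \<open>k\<close> needs at most \<open>2\<^sup>k\<^sup>+\<^sup>2\<close> states. Cutting after
  \<open>k\<close> of \<open>2k\<close> values, suitable control bits turn the function into the equality of the read
  with the unread values, which has a fooling set of size \<open>2\<^sup>k\<close>.

  For \<open>NOBDD\<^sup>d\<^sup>' \<not>\<subseteq> OBDD\<^sup>d\<close>, the control bit says whether the value belongs to a data string or to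
  a pointer of \<open>L\<close> bits into it. A nondeterministic program guesses the pointer, with
  \<open>O(K\<^sup>2 L)\<close> states for data of length \<open>K\<close>. Cutting after \<open>K\<close> values, declared to be
  the data, leaves all \<open>2\<^sup>K\<close> data strings distinguishable by the \<open>L\<close> unread values.

  The inclusion in (i) is the subset construction, and it is strict by the first separation.
\<close>

section \<open>Programs from automata\<close>

text \<open>A leveled automaton becomes a program once its states are numbered. Tagging each code
  with its level makes the levels disjoint even when the sets \<open>Q j\<close> overlap.
  Determinism appears as a final implication, so that one construction serves both models.\<close>

lemma exists_obdd_of_states:
  fixes Q :: "nat \<Rightarrow> 's set" and R :: "nat \<Rightarrow> 's \<Rightarrow> bool \<Rightarrow> 's \<Rightarrow> bool"
  assumes fin: "\<And>j. j \<le> n \<Longrightarrow> finite (Q j)" and card: "\<And>j. j \<le> n \<Longrightarrow> card (Q j) \<le> d"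
    and Q0: "Q 0 = {s0}"
    and closed: "\<And>j s b t. j < n \<Longrightarrow> s \<in> Q j \<Longrightarrow> R j s b t \<Longrightarrow> t \<in> Q (Suc j)"
    and perm: "\<pi> permutes {1..n}"
    and f: "\<And>\<nu>. \<nu> \<in> inputs n \<Longrightarrow> f \<nu> \<longleftrightarrow>
      (\<exists>p. p 0 = s0 \<and> (\<forall>j<n. R j (p j) (\<nu> (\<pi> (Suc j))) (p (Suc j))) \<and> p n \<in> F)"
  shows "\<exists>B :: nat bdd. nondeterministic_obdd n B \<and> width n B \<le> d \<and> computes n B f \<and>
    ((\<forall>j<n. \<forall>s\<in>Q j. \<forall>b. \<exists>!t. R j s b t) \<longrightarrow> deterministic_obdd n B)"
proof -
  have "\<exists>e :: 's \<Rightarrow> nat. inj_on e (Q j)" if "j \<le> n" for j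
    using finite_imp_inj_to_nat_seg[OF fin[OF that]] by blast
  then obtain e :: "nat \<Rightarrow> 's \<Rightarrow> nat" where e: "\<And>j. j \<le> n \<Longrightarrow> inj_on (e j) (Q j)"
    by metis
  define enc where "enc j s = prod_encode (j, e j s)" for j s
  have enc_eq: "enc j s = enc j' t \<longleftrightarrow> j = j' \<and> s = t"
    if "j \<le> n" "s \<in> Q j" "t \<in> Q j'" for j j' s t
    using e[OF that(1)] that by (auto simp: enc_def prod_encode_eq dest: inj_onD)
  define B :: "nat bdd" where "B = \<lparr>level = (\<lambda>j. enc j ` Q j), source = enc 0 s0,
    edges = {(enc j s, b, enc (Suc j) t) | j s b t. j < n \<and> s \<in> Q j \<and> R j s b t},
    var_order = \<pi>, accepting = enc n ` (F \<inter> Q n)\<rparr>"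
  have B: "level B j = enc j ` Q j" "source B = enc 0 s0" "var_order B = \<pi>"
    "accepting B = enc n ` (F \<inter> Q n)"
    "edges B = {(enc j s, b, enc (Suc j) t) | j s b t. j < n \<and> s \<in> Q j \<and> R j s b t}" for j
    by (simp_all add: B_def)
  have edge: "(enc j s, b, v) \<in> edges B \<longleftrightarrow> (\<exists>t. v = enc (Suc j) t \<and> R j s b t)"
    if "j < n" "s \<in> Q j" for j s b v
  proof
    assume "(enc j s, b, v) \<in> edges B"
    then obtain j' s' t where *: "enc j s = enc j' s'" "v = enc (Suc j') t" "j' < n" "s' \<in> Q j'"
      "R j' s' b t" by (auto simp: B)
    then have "j = j' \<and> s = s'" using that enc_eq[of j s s' j'] by simp
    with * show "\<exists>t. v = enc (Suc j) t \<and> R j s b t" by auto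
  qed (use that in \<open>auto simp: B\<close>)
  have nd: "nondeterministic_obdd n B"
    unfolding nondeterministic_obdd_def
  proof (intro conjI)
    show "disjoint_family_on (level B) {0..n}"
      unfolding disjoint_family_on_def B by (auto simp: enc_eq)
    show "edges B \<subseteq> (\<Union>j\<in>{1..n}. level B (j - 1) \<times> UNIV \<times> level B j)"
    proof
      fix x assume "x \<in> edges B"
      then obtain j s b t where x: "x = (enc j s, b, enc (Suc j) t)" "j < n" "s \<in> Q j" "R j s b t"
        by (auto simp: B)
      then have "x \<in> level B (Suc j - 1) \<times> UNIV \<times> level B (Suc j)"
        using closed by (auto simp: B)
      then show "x \<in> (\<Union>j\<in>{1..n}. level B (j - 1) \<times> UNIV \<times> level B j)"
        using x(2) by (intro UN_I[of "Suc j"]) auto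
    qed
  qed (use perm fin in \<open>auto simp: B Q0\<close>)
  have w: "width n B \<le> d"
    unfolding width_def B using card fin by (auto intro: order_trans[OF card_image_le])
  have c: "computes n B f"
    unfolding computes_def
  proof
    fix \<nu> assume \<nu>: "\<nu> \<in> inputs n"
    show "f \<nu> \<longleftrightarrow> obdd_output n B \<nu>"
    proof
      assume "f \<nu>"
      then obtain p where p: "p 0 = s0" "\<And>j. j < n \<Longrightarrow> R j (p j) (\<nu> (\<pi> (Suc j))) (p (Suc j))"
        "p n \<in> F" using f[OF \<nu>] by auto
      have pQ: "p j \<in> Q j" if "j \<le> n" for j
        using that
      proof (induction j)
        case (Suc j)
        then show ?case using closed[OF _ _ p(2)] by simp
      qed (use p Q0 in auto)
      have "consistent_path n B \<nu> (restrict (\<lambda>j. enc j (p j)) {0..n})"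
        unfolding consistent_path_def
      proof (intro conjI ballI)
        fix j assume j: "j \<in> {1..n}"
        then have "(enc (j - 1) (p (j - 1)), \<nu> (\<pi> j), enc j (p j)) \<in> edges B"
          using p(2)[of "j - 1"] pQ[of "j - 1"] by (subst edge) auto
        with j show "(restrict (\<lambda>j. enc j (p j)) {0..n} (j - 1), \<nu> (var_order B j),
           restrict (\<lambda>j. enc j (p j)) {0..n} j) \<in> edges B" by (auto simp: B(3))
      qed (simp_all add: B p)
      moreover have "enc n (p n) \<in> accepting B" using p pQ[of n] by (auto simp: B)
      ultimately show "obdd_output n B \<nu>"
        unfolding obdd_output_def by (intro exI[of _ "restrict (\<lambda>j. enc j (p j)) {0..n}"]) simp
    next
      assume "obdd_output n B \<nu>"
      then obtain p where p: "p 0 = enc 0 s0" "p n \<in> accepting B"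
        "\<forall>j\<in>{1..n}. (p (j - 1), \<nu> (\<pi> j), p j) \<in> edges B"
        unfolding obdd_output_def consistent_path_def B(3) B(2) by blast
      have pe: "(p j, \<nu> (\<pi> (Suc j)), p (Suc j)) \<in> edges B" if "j < n" for j
        using bspec[OF p(3), of "Suc j"] that by simp
      have "\<exists>s. s \<in> Q j \<and> p j = enc j s" if "j \<le> n" for j
        using that
      proof (induction j)
        case (Suc j)
        then obtain s where "s \<in> Q j" "p j = enc j s" by auto
        with pe[of j] Suc.prems closed[of j s] show ?case by (auto simp: edge)
      qed (use p Q0 in auto)
      then obtain q where q: "\<And>j. j \<le> n \<Longrightarrow> q j \<in> Q j \<and> p j = enc j (q j)" by metis
      have "q 0 = s0" using q[of 0] Q0 by simp
      moreover have "R j (q j) (\<nu> (\<pi> (Suc j))) (q (Suc j))" if j: "j < n" for j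
      proof -
        obtain t where t: "enc (Suc j) (q (Suc j)) = enc (Suc j) t" "R j (q j) (\<nu> (\<pi> (Suc j))) t"
          using pe[OF j] q[of j] q[of "Suc j"] j by (auto simp: edge)
        \<comment> \<open>\<open>enc\<close> is injective only on the state sets, so
          \<open>t\<close> must be known to lie in \<open>Q (Suc j)\<close> before it can be
          identified with \<open>q (Suc j)\<close>.\<close>
        moreover have "t \<in> Q (Suc j)" using closed[OF j _ t(2)] q[of j] j by simp
        ultimately show ?thesis using enc_eq[of "Suc j" "q (Suc j)" t] q[of "Suc j"] j by simp
      qed
      moreover have "q n \<in> F" using p(2) q[of n] by (auto simp: B enc_eq)
      ultimately show "f \<nu>" using f[OF \<nu>] by blast
    qed
  qed
  have "deterministic_obdd n B" if det: "\<forall>j<n. \<forall>s\<in>Q j. \<forall>b. \<exists>!t. R j s b t"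
    unfolding deterministic_obdd_def
  proof (intro conjI ballI allI nd)
    fix j u b assume j: "j \<in> {1..n}" and "u \<in> level B (j - 1)"
    then obtain s where s: "s \<in> Q (j - 1)" "u = enc (j - 1) s" by (auto simp: B)
    then show "\<exists>!v. (u, b, v) \<in> edges B"
      using j det[rule_format, of "j - 1" s b] edge[of "j - 1" s b] by fastforce
  qed
  with nd w c show ?thesis by blast
qed

text \<open>A transition function has only one run on a given input, so it is enough to exhibit some
  run whose last state decides \<open>f\<close>.\<close>

lemma OBDD_I:
  fixes Q :: "nat \<Rightarrow> 's set" and \<delta> :: "nat \<Rightarrow> 's \<Rightarrow> bool \<Rightarrow> 's"
  assumes fb: "f \<in> boolean_functions n"
    and fin: "\<And>j. j \<le> n \<Longrightarrow> finite (Q j)" and card: "\<And>j. j \<le> n \<Longrightarrow> card (Q j) \<le> d"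
    and Q0: "Q 0 = {s0}"
    and closed: "\<And>j s b. j < n \<Longrightarrow> s \<in> Q j \<Longrightarrow> \<delta> j s b \<in> Q (Suc j)"
    and perm: "\<pi> permutes {1..n}"
    and f: "\<And>\<nu>. \<nu> \<in> inputs n \<Longrightarrow> \<exists>p. p 0 = s0 \<and>
      (\<forall>j<n. p (Suc j) = \<delta> j (p j) (\<nu> (\<pi> (Suc j)))) \<and> (f \<nu> \<longleftrightarrow> p n \<in> F)"
  shows "f \<in> OBDD n d"
proof -
  have run: "f \<nu> \<longleftrightarrow> (\<exists>p. p 0 = s0 \<and> (\<forall>j<n. p (Suc j) = \<delta> j (p j) (\<nu> (\<pi> (Suc j)))) \<and> p n \<in> F)"
    if \<nu>: "\<nu> \<in> inputs n" for \<nu>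
  proof -
    obtain p where p: "p 0 = s0" "\<forall>j<n. p (Suc j) = \<delta> j (p j) (\<nu> (\<pi> (Suc j)))"
      "f \<nu> \<longleftrightarrow> p n \<in> F" using f[OF \<nu>] by blast
    have "q n = p n" if q: "q 0 = s0" "\<forall>j<n. q (Suc j) = \<delta> j (q j) (\<nu> (\<pi> (Suc j)))" for q
    proof -
      have "q j = p j" if "j \<le> n" for j
        using that by (induction j) (use p q in auto)
      then show ?thesis by simp
    qed
    with p show ?thesis by metis
  qed
  have "\<exists>B :: nat bdd. nondeterministic_obdd n B \<and> width n B \<le> d \<and> computes n B f \<and>
    ((\<forall>j<n. \<forall>s\<in>Q j. \<forall>b. \<exists>!t. t = \<delta> j s b) \<longrightarrow> deterministic_obdd n B)"
    by (rule exists_obdd_of_states[where R = "\<lambda>j s b t. t = \<delta> j s b" and \<pi> = \<pi> and ?s0.0 = s0 and F = F])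
      (use fin card Q0 closed perm run in simp_all)
  then show ?thesis unfolding OBDD_def using fb by auto
qed

section \<open>Widths and paths\<close>

lemma card_level_le_width:
  assumes "j \<le> n"
  shows "card (level B j) \<le> width n B"
  unfolding width_def using assms by (intro Max_ge) auto

lemma NOBDD_mono: "d \<le> d' \<Longrightarrow> NOBDD n d \<subseteq> NOBDD n d'"
  unfolding NOBDD_def using order_trans by blast

lemma consistent_path_edge:
  assumes "consistent_path n B \<nu> p" "j < n"
  shows "(p j, \<nu> (var_order B (Suc j)), p (Suc j)) \<in> edges B"
proof -
  have "\<forall>j\<in>{1..n}. (p (j - 1), \<nu> (var_order B j), p j) \<in> edges B"
    using assms(1) by (simp add: consistent_path_def)
  from bspec[OF this, of "Suc j"] assms(2) show ?thesis by simp
qed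

lemma edge_level:
  assumes B: "nondeterministic_obdd n B" and "j < n" "u \<in> level B j" "(u, b, v) \<in> edges B"
  shows "v \<in> level B (Suc j)"
proof -
  have dis: "disjoint_family_on (level B) {0..n}"
    and sub: "edges B \<subseteq> (\<Union>j\<in>{1..n}. level B (j - 1) \<times> UNIV \<times> level B j)"
    using B by (simp_all add: nondeterministic_obdd_def)
  obtain i where i: "i \<in> {1..n}" "u \<in> level B (i - 1)" "v \<in> level B i"
    using subsetD[OF sub assms(4)] by auto
  have "i - 1 = j"
  proof (rule ccontr)
    assume "i - 1 \<noteq> j"
    then have "level B (i - 1) \<inter> level B j = {}"
      using i(1) assms(2) by (intro disjoint_family_onD[OF dis]) auto
    with i(2) assms(3) show False by blast
  qed
  with i show ?thesis by auto
qed

lemma consistent_path_level: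
  assumes B: "nondeterministic_obdd n B" and p: "consistent_path n B \<nu> p" and "j \<le> n"
  shows "p j \<in> level B j"
  using assms(3)
proof (induction j)
  case 0
  then show ?case using B p by (simp add: nondeterministic_obdd_def consistent_path_def)
next
  case (Suc j)
  then show ?case using edge_level[OF B _ _ consistent_path_edge[OF p]] by simp
qed

text \<open>The cut-and-paste principle behind both lower bounds: a program remembers only the node
  reached. Each variable is read once, so the bits read up to level \<open>l\<close> can come from
  \<open>x\<close> and all later bits from \<open>y\<close>.\<close>

lemma consistent_path_paste:
  assumes B: "nondeterministic_obdd n B"
    and p: "consistent_path n B x p" and q: "consistent_path n B y q"
    and l: "l \<le> n" "p l = q l"
  shows "consistent_path n B (override_on y x (var_order B ` {1..l})) (\<lambda>j. if j \<le> l then p j else q j)"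
proof -
  have perm: "var_order B permutes {1..n}" using B by (simp add: nondeterministic_obdd_def)
  have mem: "var_order B j \<in> var_order B ` {1..l} \<longleftrightarrow> j \<le> l" if "j \<in> {1..n}" for j
    using that by (simp add: inj_image_mem_iff[OF permutes_inj[OF perm]])
  show ?thesis
    unfolding consistent_path_def
  proof (intro conjI ballI)
    show "(\<lambda>j. if j \<le> l then p j else q j) \<in> extensional {0..n}"
      using q l by (auto simp: consistent_path_def extensional_def)
    show "(if 0 \<le> l then p 0 else q 0) = source B" using p by (simp add: consistent_path_def)
    fix j assume j: "j \<in> {1..n}"
    then have e: "(p (j - 1), x (var_order B j), p j) \<in> edges B"
      "(q (j - 1), y (var_order B j), q j) \<in> edges B"
      using consistent_path_edge[OF p, of "j - 1"] consistent_path_edge[OF q, of "j - 1"] by auto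
    \<comment> \<open>The seam is \<open>j = Suc l\<close>: the edge of \<open>q\<close> leaving
      \<open>q l\<close> is used from \<open>p l\<close>, which is the same node.\<close>
    consider "j \<le> l" | "j = Suc l" | "j > Suc l" by linarith
    then show "(if j - 1 \<le> l then p (j - 1) else q (j - 1),
        override_on y x (var_order B ` {1..l}) (var_order B j), if j \<le> l then p j else q j) \<in> edges B"
      by cases (use e l mem[OF j] in \<open>auto simp: override_on_def\<close>)
  qed
qed

lemma override_on_inputs:
  "x \<in> inputs n \<Longrightarrow> y \<in> inputs n \<Longrightarrow> override_on y x V \<in> inputs n"
  by (auto simp: inputs_def override_on_def PiE_def extensional_def)

section \<open>Lower bound methods\<close>

text \<open>If the accepting paths of \<open>w\<close> and \<open>w'\<close> met at level
  \<open>l\<close>, their pasting would accept the mixed input. Hence different \<open>w\<close>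
  occupy different nodes of that level. The order is chosen by the program, so \<open>l\<close> and
  the inputs may depend on it.\<close>

lemma NOBDD_fooling_set:
  assumes "f \<in> NOBDD n d"
  shows "\<exists>\<pi>. \<pi> permutes {1..n} \<and> (\<forall>l W (x :: 'w \<Rightarrow> nat \<Rightarrow> bool).
      l \<le> n \<longrightarrow> (\<forall>w\<in>W. x w \<in> inputs n) \<longrightarrow> (\<forall>w\<in>W. f (x w)) \<longrightarrow>
      (\<forall>w\<in>W. \<forall>w'\<in>W. f (override_on (x w') (x w) (\<pi> ` {1..l})) \<longrightarrow> w = w') \<longrightarrow> card W \<le> d)"
proof -
  obtain B :: "nat bdd" where B: "nondeterministic_obdd n B" "width n B \<le> d" "computes n B f"
    using assms by (auto simp: NOBDD_def)
  show ?thesis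
  proof (intro exI[of _ "var_order B"] conjI allI impI)
    show "var_order B permutes {1..n}" using B by (simp add: nondeterministic_obdd_def)
    fix l W and x :: "'w \<Rightarrow> nat \<Rightarrow> bool"
    assume l: "l \<le> n" and "\<forall>w\<in>W. x w \<in> inputs n" "\<forall>w\<in>W. f (x w)"
      and sep: "\<forall>w\<in>W. \<forall>w'\<in>W. f (override_on (x w') (x w) (var_order B ` {1..l})) \<longrightarrow> w = w'"
    then have x: "\<And>w. w \<in> W \<Longrightarrow> x w \<in> inputs n" "\<And>w. w \<in> W \<Longrightarrow> f (x w)" by blast+
    have "\<exists>p. consistent_path n B (x w) p \<and> p n \<in> accepting B" if "w \<in> W" for w
      using x[OF that] B(3) by (auto simp: computes_def obdd_output_def)
    then obtain p where p: "\<And>w. w \<in> W \<Longrightarrow> consistent_path n B (x w) (p w)"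
      "\<And>w. w \<in> W \<Longrightarrow> p w n \<in> accepting B" by metis
    have "inj_on (\<lambda>w. p w l) W"
    proof
      fix w w' assume w: "w \<in> W" "w' \<in> W" and eq: "p w l = p w' l"
      let ?x = "override_on (x w') (x w) (var_order B ` {1..l})"
      let ?p = "\<lambda>j. if j \<le> l then p w j else p w' j"
      have "consistent_path n B ?x ?p"
        using consistent_path_paste[OF B(1) p(1)[OF w(1)] p(1)[OF w(2)] l eq] .
      moreover have "?p n \<in> accepting B" using p(2) w l eq by auto
      ultimately have "obdd_output n B ?x" unfolding obdd_output_def by blast
      then have "f ?x" using B(3) override_on_inputs[OF x(1)[OF w(1)] x(1)[OF w(2)]]
        by (simp add: computes_def)
      then show "w = w'" using sep w by blast
    qed
    moreover have "(\<lambda>w. p w l) ` W \<subseteq> level B l"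
      using consistent_path_level[OF B(1) p(1) l] by auto
    moreover have "finite (level B l)" using B(1) l by (simp add: nondeterministic_obdd_def)
    ultimately have "card W \<le> card (level B l)" by (rule card_inj_on_le)
    also have "\<dots> \<le> d" using card_level_le_width[OF l, of B] B(2) by simp
    finally show "card W \<le> d" .
  qed
qed

text \<open>In a deterministic program the node at level \<open>l\<close> determines the function of
  the remaining variables, so prefixes with different subfunctions end in different nodes. Unlike
  the fooling set bound, this fails for nondeterministic programs, where a prefix may reach several
  nodes.\<close>

lemma OBDD_subfunctions:
  assumes "f \<in> OBDD n d"
  shows "\<exists>\<pi>. \<pi> permutes {1..n} \<and> (\<forall>l W (x :: 'w \<Rightarrow> nat \<Rightarrow> bool).
      l \<le> n \<longrightarrow> (\<forall>w\<in>W. x w \<in> inputs n) \<longrightarrow>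
      (\<forall>w\<in>W. \<forall>w'\<in>W. w \<noteq> w' \<longrightarrow> (\<exists>y\<in>inputs n.
         f (override_on y (x w) (\<pi> ` {1..l})) \<noteq> f (override_on y (x w') (\<pi> ` {1..l})))) \<longrightarrow>
      card W \<le> d)"
proof -
  obtain B :: "nat bdd" where det: "deterministic_obdd n B" and B: "width n B \<le> d" "computes n B f"
    using assms by (auto simp: OBDD_def)
  then have nd: "nondeterministic_obdd n B" by (simp add: deterministic_obdd_def)
  show ?thesis
  proof (intro exI[of _ "var_order B"] conjI allI impI)
    show "var_order B permutes {1..n}" using nd by (simp add: nondeterministic_obdd_def)
    fix l W and x :: "'w \<Rightarrow> nat \<Rightarrow> bool"
    assume l: "l \<le> n" and "\<forall>w\<in>W. x w \<in> inputs n"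
      and sep: "\<forall>w\<in>W. \<forall>w'\<in>W. w \<noteq> w' \<longrightarrow> (\<exists>y\<in>inputs n.
         f (override_on y (x w) (var_order B ` {1..l})) \<noteq> f (override_on y (x w') (var_order B ` {1..l})))"
    then have x: "\<And>w. w \<in> W \<Longrightarrow> x w \<in> inputs n" by blast
    obtain P where P: "\<And>\<nu>. consistent_path n B \<nu> (P \<nu>)"
      using deterministic_obdd_unique_path[OF det] by metis
    have uniq: "p = q" if "consistent_path n B \<nu> p" "consistent_path n B \<nu> q" for \<nu> p q
      using deterministic_obdd_unique_path[OF det, of \<nu>] that by blast
    have "inj_on (\<lambda>w. P (x w) l) W"
    proof (rule inj_onI, rule ccontr)
      fix w w' assume w: "w \<in> W" "w' \<in> W" and eq: "P (x w) l = P (x w') l" and "w \<noteq> w'"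
      then obtain y where y: "y \<in> inputs n" and ne:
        "f (override_on y (x w) (var_order B ` {1..l})) \<noteq> f (override_on y (x w') (var_order B ` {1..l}))"
        using sep by blast
      define V where "V = var_order B ` {1..l}"
      define r where "r = P (override_on y (x w) V)"
      \<comment> \<open>The prefix of a path depends only on the bits of \<open>V\<close>, so both mixed inputs visit the
        node shared by \<open>x w\<close> and \<open>x w'\<close>, and continue identically from there.\<close>
      have r: "consistent_path n B (override_on y (x w) V) r" unfolding r_def by (rule P)
      have "P (x w) j = r j" if "j \<le> l" for j
        using that
      proof (induction j)
        case 0
        then show ?case using P[of "x w"] r by (simp add: consistent_path_def)
      next
        case (Suc j)
        have e1: "(P (x w) j, x w (var_order B (Suc j)), P (x w) (Suc j)) \<in> edges B"
          using consistent_path_edge[OF P] Suc.prems l by simp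
        have "var_order B (Suc j) \<in> V" using Suc.prems by (auto simp: V_def)
        then have e2: "(r j, x w (var_order B (Suc j)), r (Suc j)) \<in> edges B"
          using consistent_path_edge[OF r, of j] Suc.prems l by (simp add: override_on_def)
        have "r j \<in> level B (Suc j - 1)" "Suc j \<in> {1..n}"
          using consistent_path_level[OF nd r, of j] Suc.prems l by auto
        then have "\<forall>b. \<exists>!v. (r j, b, v) \<in> edges B"
          using det unfolding deterministic_obdd_def by blast
        with e1 e2 Suc show ?case by auto
      qed
      then have rl: "r l = P (x w) l" by simp
      then have "consistent_path n B (override_on (override_on y (x w) V) (x w') V)
          (\<lambda>j. if j \<le> l then P (x w') j else r j)"
        unfolding V_def using consistent_path_paste[OF nd P r[unfolded V_def] l] eq V_def by simp
      moreover have "override_on (override_on y (x w) V) (x w') V = override_on y (x w') V"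
        by (auto simp: override_on_def)
      ultimately have r': "consistent_path n B (override_on y (x w') V)
          (\<lambda>j. if j \<le> l then P (x w') j else r j)" (is "consistent_path _ _ _ ?r") by simp
      \<comment> \<open>For \<open>l = n\<close> the pasted path ends in its first branch, where the
        common node at level \<open>l\<close> is needed once more.\<close>
      have "?r n = r n" using rl eq l by (cases "n = l") auto
      moreover have "obdd_output n B (override_on y (x w) V) \<longleftrightarrow> r n \<in> accepting B"
        unfolding obdd_output_def using uniq[OF r] r by blast
      moreover have "obdd_output n B (override_on y (x w') V) \<longleftrightarrow> ?r n \<in> accepting B"
        unfolding obdd_output_def using uniq[OF r'] r' by blast
      ultimately have "obdd_output n B (override_on y (x w) V) \<longleftrightarrow>
          obdd_output n B (override_on y (x w') V)" by simp
      then show False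
        using ne B(2) override_on_inputs[OF x[OF w(1)] y] override_on_inputs[OF x[OF w(2)] y]
        by (simp add: computes_def V_def)
    qed
    moreover have "(\<lambda>w. P (x w) l) ` W \<subseteq> level B l"
      using consistent_path_level[OF nd P l] by auto
    moreover have "finite (level B l)" using nd l by (simp add: nondeterministic_obdd_def)
    ultimately have "card W \<le> card (level B l)" by (rule card_inj_on_le)
    also have "\<dots> \<le> d" using card_level_le_width[OF l, of B] B(1) by simp
    finally show "card W \<le> d" .
  qed
qed

text \<open>A discrete intermediate value argument: each step reads one variable, so the count grows
  by at most one, and the first \<open>l\<close> at which it reaches \<open>t\<close> hits
  \<open>t\<close> exactly.\<close>

lemma order_cut:
  fixes \<pi> :: "nat \<Rightarrow> nat"
  assumes "\<pi> permutes {1..n}" "V \<subseteq> {1..n}" "t \<le> card V"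
  obtains l where "l \<le> n" "card (V \<inter> \<pi> ` {1..l}) = t"
proof -
  define h where "h l = card (V \<inter> \<pi> ` {1..l})" for l :: nat
  have step: "h (Suc l) \<le> Suc (h l)" for l
  proof -
    have "V \<inter> \<pi> ` {1..Suc l} \<subseteq> insert (\<pi> (Suc l)) (V \<inter> \<pi> ` {1..l})"
      by (auto simp: atLeastAtMostSuc_conv)
    then have "h (Suc l) \<le> card (insert (\<pi> (Suc l)) (V \<inter> \<pi> ` {1..l}))"
      unfolding h_def by (intro card_mono) auto
    also have "\<dots> \<le> Suc (h l)" unfolding h_def by (rule card_insert_le_m1[THEN order_trans]) auto
    finally show ?thesis .
  qed
  have "h n = card V" using assms(1,2) by (simp add: h_def permutes_image Int_absorb2)
  then have ex: "t \<le> h n" using assms(3) by simp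
  define l where "l = (LEAST l. t \<le> h l)"
  have l: "t \<le> h l" "l \<le> n" unfolding l_def using ex by (auto intro: LeastI Least_le)
  have "h l \<le> t"
  proof (cases l)
    case 0
    then show ?thesis by (simp add: h_def)
  next
    case (Suc l')
    then have "\<not> t \<le> h l'" using not_less_Least[of l' "\<lambda>l. t \<le> h l"] by (simp add: l_def)
    then show ?thesis using step[of l'] Suc by simp
  qed
  then show thesis using that[OF l(2)] l(1) by (simp add: h_def)
qed

section \<open>Reading the variables in pairs\<close>

text \<open>Under the identity order, pair \<open>i\<close> consists of the adjacent variables
  \<open>2 * i + 1\<close> and \<open>2 * i + 2\<close>. The factor 2 in the width pays for storing
  the first bit of a pair; variables after the first \<open>m\<close> pairs leave the state
  unchanged.\<close>

lemma exists_obdd_of_pairs: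
  fixes Q :: "'s set" and R :: "'s \<Rightarrow> bool \<Rightarrow> bool \<Rightarrow> 's \<Rightarrow> bool"
  assumes fin: "finite Q" and card: "2 * card Q \<le> d" and s0: "s0 \<in> Q"
    and closed: "\<And>s a v t. s \<in> Q \<Longrightarrow> R s a v t \<Longrightarrow> t \<in> Q"
    and m: "2 * m \<le> n"
    and f: "\<And>\<nu>. \<nu> \<in> inputs n \<Longrightarrow> f \<nu> \<longleftrightarrow>
      (\<exists>q. q 0 = s0 \<and> (\<forall>i<m. R (q i) (\<nu> (2 * i + 1)) (\<nu> (2 * i + 2)) (q (Suc i))) \<and> q m \<in> F)"
  shows "\<exists>B :: nat bdd. nondeterministic_obdd n B \<and> width n B \<le> d \<and> computes n B f \<and>
    ((\<forall>s\<in>Q. \<forall>a v. \<exists>!t. R s a v t) \<longrightarrow> deterministic_obdd n B)"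
proof -
  \<comment> \<open>Level 0 must consist of the source alone; later levels may contain unreachable
    states, since only their number matters.\<close>
  define Q' where "Q' j = (if j = 0 then {(s0, False)} else Q \<times> (UNIV :: bool set))" for j :: nat
  \<comment> \<open>The second component stores the first bit of a pair until the second one is read.\<close>
  define R' where "R' j s b t \<longleftrightarrow> (if 2 * m \<le> j then t = s
     else if even j then t = (fst s, b)
     else R (fst s) (snd s) b (fst t) \<and> \<not> snd t)" for j :: nat and s b t
  have cardQ: "card Q \<ge> 1" using fin s0 by (metis One_nat_def Suc_leI card_gt_0_iff empty_iff)
  have Q'sub: "s \<in> Q' j \<Longrightarrow> fst s \<in> Q" for s j using s0 by (auto simp: Q'_def split: if_splits)
  have f': "f \<nu> \<longleftrightarrow> (\<exists>p. p 0 = (s0, False) \<and> (\<forall>j<n. R' j (p j) (\<nu> (id (Suc j))) (p (Suc j))) \<and>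
      p n \<in> F \<times> UNIV)" if "\<nu> \<in> inputs n" for \<nu>
    unfolding f[OF that]
  proof
    assume "\<exists>q. q 0 = s0 \<and> (\<forall>i<m. R (q i) (\<nu> (2 * i + 1)) (\<nu> (2 * i + 2)) (q (Suc i))) \<and> q m \<in> F"
    then obtain q where q: "q 0 = s0" "q m \<in> F"
      "\<And>i. i < m \<Longrightarrow> R (q i) (\<nu> (2 * i + 1)) (\<nu> (2 * i + 2)) (q (Suc i))" by blast
    \<comment> \<open>The state freezes after \<open>m\<close> pairs. At an odd time
      \<open>j\<close> before that, the stored bit is the one just read, namely variable
      \<open>j\<close>.\<close>
    define p where "p j = (q (min (j div 2) m), odd j \<and> j < 2 * m \<and> \<nu> j)" for j
    have "R' j (p j) (\<nu> (Suc j)) (p (Suc j))" if "j < n" for j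
    proof (cases "2 * m \<le> j")
      case True
      then show ?thesis by (simp add: R'_def p_def)
    next
      case False
      show ?thesis
      proof (cases "even j")
        case True
        then obtain i where "j = 2 * i" by (elim evenE)
        with False show ?thesis by (simp add: R'_def p_def)
      next
        case odd: False
        then obtain i where i: "j = 2 * i + 1" by (elim oddE)
        then have "i < m" using False by simp
        with q(3)[of i] i show ?thesis by (simp add: R'_def p_def)
      qed
    qed
    moreover have "p 0 = (s0, False)" using q by (simp add: p_def)
    moreover have "p n \<in> F \<times> UNIV" using q m by (simp add: p_def min_absorb2 less_eq_div_iff_mult_less_eq mult.commute)
    ultimately show "\<exists>p. p 0 = (s0, False) \<and> (\<forall>j<n. R' j (p j) (\<nu> (id (Suc j))) (p (Suc j))) \<and>
      p n \<in> F \<times> UNIV" by auto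
  next
    assume "\<exists>p. p 0 = (s0, False) \<and> (\<forall>j<n. R' j (p j) (\<nu> (id (Suc j))) (p (Suc j))) \<and>
      p n \<in> F \<times> UNIV"
    then obtain p where p: "p 0 = (s0, False)" "p n \<in> F \<times> UNIV"
      "\<And>j. j < n \<Longrightarrow> R' j (p j) (\<nu> (Suc j)) (p (Suc j))" by auto
    have "R (fst (p (2 * i))) (\<nu> (2 * i + 1)) (\<nu> (2 * i + 2)) (fst (p (2 * Suc i)))" if "i < m" for i
      using p(3)[of "2 * i"] p(3)[of "2 * i + 1"] that m by (simp add: R'_def)
    moreover have "p j = p (2 * m)" if "2 * m \<le> j" "j \<le> n" for j
      using that by (induction j rule: dec_induct) (use p(3) in \<open>auto simp: R'_def\<close>)
    then have "fst (p (2 * m)) \<in> F" using p(2) m by (metis mem_Times_iff order_refl)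
    ultimately show "\<exists>q. q 0 = s0 \<and>
        (\<forall>i<m. R (q i) (\<nu> (2 * i + 1)) (\<nu> (2 * i + 2)) (q (Suc i))) \<and> q m \<in> F"
      using p(1) by (intro exI[of _ "\<lambda>i. fst (p (2 * i))"]) simp
  qed
  have "\<exists>B :: nat bdd. nondeterministic_obdd n B \<and> width n B \<le> d \<and> computes n B f \<and>
    ((\<forall>j<n. \<forall>s\<in>Q' j. \<forall>b. \<exists>!t. R' j s b t) \<longrightarrow> deterministic_obdd n B)"
  proof (rule exists_obdd_of_states[where \<pi> = id and ?s0.0 = "(s0, False)" and F = "F \<times> UNIV"])
    show "finite (Q' j)" for j using fin by (simp add: Q'_def)
    show "card (Q' j) \<le> d" for j using card cardQ by (simp add: Q'_def card_cartesian_product)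
    show "Q' 0 = {(s0, False)}" by (simp add: Q'_def)
    show "t \<in> Q' (Suc j)" if "s \<in> Q' j" "R' j s b t" for j s b t
      using that closed[OF Q'sub[OF that(1)]] Q'sub[OF that(1)]
      by (cases t) (auto simp: Q'_def[of "Suc j"] R'_def split: if_splits)
    show "id permutes {1..n}" by (rule permutes_id)
  qed (fact f')
  moreover have "\<exists>!t. R' j s b t" if det: "\<forall>s\<in>Q. \<forall>a v. \<exists>!t. R s a v t" and s: "s \<in> Q' j" for j s b
  proof -
    have "\<exists>!t. R (fst s) (snd s) b t" using det Q'sub[OF s] by blast
    then obtain t where t: "R (fst s) (snd s) b t" and uniq: "\<And>t'. R (fst s) (snd s) b t' \<Longrightarrow> t' = t"
      by (elim ex1E) blast
    have "\<exists>!t. R (fst s) (snd s) b (fst t) \<and> \<not> snd t"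
      by (rule ex1I[of _ "(t, False)"]) (simp_all add: t prod_eq_iff uniq)
    then show ?thesis by (cases "2 * m \<le> j"; cases "even j") (simp_all add: R'_def)
  qed
  then have "(\<forall>s\<in>Q. \<forall>a v. \<exists>!t. R s a v t) \<Longrightarrow> \<forall>j<n. \<forall>s\<in>Q' j. \<forall>b. \<exists>!t. R' j s b t"
    by simp
  ultimately show ?thesis by (elim exE conjE) (intro exI conjI impI; simp)
qed

section \<open>Cuts by the number of value bits, and inputs given by control and value bits\<close>

lemma value_cut:
  fixes \<pi> :: "nat \<Rightarrow> nat"
  assumes "\<pi> permutes {1..n}" "2 * m \<le> n" "t \<le> m"
  obtains l where "l \<le> n" "card {j. j < m \<and> 2 * j + 2 \<in> \<pi> ` {1..l}} = t"
proof -
  let ?g = "\<lambda>j::nat. 2 * j + 2"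
  have inj: "inj_on ?g S" for S by (auto simp: inj_on_def)
  have "?g ` {..<m} \<subseteq> {1..n}" using assms(2) by auto
  moreover have "t \<le> card (?g ` {..<m})" using assms(3) by (simp add: card_image inj_on_def)
  ultimately obtain l where l: "l \<le> n" "card (?g ` {..<m} \<inter> \<pi> ` {1..l}) = t"
    using order_cut[OF assms(1)] by metis
  have "?g ` {..<m} \<inter> \<pi> ` {1..l} = ?g ` {j. j < m \<and> ?g j \<in> \<pi> ` {1..l}}" by auto
  then have "card {j. j < m \<and> ?g j \<in> \<pi> ` {1..l}} = t"
    using l(2) card_image[OF inj, of "{j. j < m \<and> ?g j \<in> \<pi> ` {1..l}}"] by (simp only:)
  with that l(1) show thesis .
qed

definition pair_input :: "nat \<Rightarrow> (nat \<Rightarrow> bool) \<Rightarrow> (nat \<Rightarrow> bool) \<Rightarrow> nat \<Rightarrow> bool" where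
  "pair_input n a v = restrict (\<lambda>i. if odd i then a (i div 2) else v (i div 2 - 1)) {1..n}"

lemma pair_input_inputs: "pair_input n a v \<in> inputs n"
  by (simp add: pair_input_def inputs_def)

text \<open>Both inputs have the same control bits, so it is irrelevant on which side of the cut a
  control variable is read. Only the values are mixed.\<close>

lemma override_on_pair_input:
  assumes "i < m" "2 * m \<le> n"
  shows "override_on (pair_input n a v') (pair_input n a v) V (Suc (2 * i)) = a i"
    and "override_on (pair_input n a v') (pair_input n a v) V (Suc (Suc (2 * i))) =
      (if 2 * i + 2 \<in> V then v i else v' i)"
  using assms by (auto simp: pair_input_def override_on_def)

section \<open>The queue function\<close>

fun queue_step :: "nat \<Rightarrow> bool list option \<Rightarrow> bool \<Rightarrow> bool \<Rightarrow> bool list option" where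
  "queue_step k None a v = None"
| "queue_step k (Some q) a v =
    (if a then if length q < k then Some (q @ [v]) else None
     else if q \<noteq> [] \<and> hd q = v then Some (tl q) else None)"

primrec queue_run :: "nat \<Rightarrow> (nat \<Rightarrow> bool) \<Rightarrow> nat \<Rightarrow> bool list option" where
  "queue_run k \<nu> 0 = Some []"
| "queue_run k \<nu> (Suc i) = queue_step k (queue_run k \<nu> i) (\<nu> (2 * i + 1)) (\<nu> (2 * i + 2))"

definition queue_function :: "nat \<Rightarrow> nat \<Rightarrow> (nat \<Rightarrow> bool) \<Rightarrow> bool" where
  "queue_function n k = restrict (\<lambda>\<nu>. queue_run k \<nu> (2 * k) = Some []) (inputs n)"

text \<open>There are \<open>2 ^ (k + 1) - 1\<close> words of length at most \<open>k\<close>; the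
  failure state \<open>None\<close> makes this \<open>2 ^ (k + 1)\<close>, and reading in pairs
  doubles it.\<close>

lemma queue_function_OBDD:
  assumes "4 * k \<le> n" "2 ^ (k + 2) \<le> d"
  shows "queue_function n k \<in> OBDD n d"
proof -
  define L where "L = {q :: bool list. set q \<subseteq> UNIV \<and> length q \<le> k}"
  have finL: "finite L" unfolding L_def by (rule finite_lists_length_le) simp
  have "card L + 1 = 2 ^ (k + 1)"
  proof -
    have "card L = (\<Sum>i\<le>k. 2 ^ i)"
      unfolding L_def by (subst card_lists_length_le) simp_all
    also have "\<dots> + 1 = 2 ^ (k + 1)" by (induction k) auto
    finally show ?thesis .
  qed
  then have card: "card (insert None (Some ` L)) = 2 ^ (k + 1)"
    using finL by (subst card_insert_disjoint) (auto simp: card_image)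
  define R where "R s a v t \<longleftrightarrow> t = queue_step k s a v" for s a v t
  have "\<exists>B :: nat bdd. nondeterministic_obdd n B \<and> width n B \<le> d \<and> computes n B (queue_function n k) \<and>
    ((\<forall>s\<in>insert None (Some ` L). \<forall>a v. \<exists>!t. R s a v t) \<longrightarrow> deterministic_obdd n B)"
  proof (rule exists_obdd_of_pairs[where m = "2 * k" and ?s0.0 = "Some []" and F = "{Some []}"])
    show "t \<in> insert None (Some ` L)" if "s \<in> insert None (Some ` L)" "R s a v t" for s a v t
      using that by (cases s) (auto simp: R_def L_def split: if_splits)
    fix \<nu> assume "\<nu> \<in> inputs n"
    have uniq: "q i = queue_run k \<nu> i" if "q 0 = Some []" "i \<le> 2 * k"
      "\<forall>i<2 * k. R (q i) (\<nu> (2 * i + 1)) (\<nu> (2 * i + 2)) (q (Suc i))" for q i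
      using that(2) by (induction i) (use that(1,3) in \<open>auto simp: R_def\<close>)
    have "queue_function n k \<nu> \<longleftrightarrow> queue_run k \<nu> (2 * k) = Some []"
      using \<open>\<nu> \<in> inputs n\<close> by (simp add: queue_function_def)
    also have "\<dots> \<longleftrightarrow> (\<exists>q. q 0 = Some [] \<and>
      (\<forall>i<2 * k. R (q i) (\<nu> (2 * i + 1)) (\<nu> (2 * i + 2)) (q (Suc i))) \<and> q (2 * k) \<in> {Some []})"
    proof
      assume "queue_run k \<nu> (2 * k) = Some []"
      then show "\<exists>q. q 0 = Some [] \<and>
        (\<forall>i<2 * k. R (q i) (\<nu> (2 * i + 1)) (\<nu> (2 * i + 2)) (q (Suc i))) \<and> q (2 * k) \<in> {Some []}"
        by (intro exI[of _ "queue_run k \<nu>"]) (simp add: R_def)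
    qed (use uniq in fastforce)
    finally show "queue_function n k \<nu> \<longleftrightarrow> (\<exists>q. q 0 = Some [] \<and>
      (\<forall>i<2 * k. R (q i) (\<nu> (2 * i + 1)) (\<nu> (2 * i + 2)) (q (Suc i))) \<and> q (2 * k) \<in> {Some []})" .
  qed (use finL card assms in \<open>auto simp: L_def\<close>)
  then show ?thesis
    unfolding OBDD_def by (auto simp: R_def boolean_functions_def queue_function_def)
qed

text \<open>For every set \<open>A\<close> of positions the control bits can be chosen so that the \<open>i\<close>-th value
  inside \<open>A\<close> is compared with the \<open>i\<close>-th value outside \<open>A\<close>: the queue always holds the
  surplus of the side that is ahead.\<close>

definition queue_control :: "nat set \<Rightarrow> nat \<Rightarrow> bool" where
  "queue_control A j = (if j \<in> A then card ({..<j} - A) \<le> card ({..<j} \<inter> A)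
     else card ({..<j} \<inter> A) \<le> card ({..<j} - A))"

text \<open>The invariant of the run: \<open>p j\<close> and \<open>q j\<close> count the values
  seen inside and outside \<open>A\<close>. The first \<open>min (p j) (q j)\<close> of both sides
  have been compared, and the queue holds the rest of the longer side. The bounds on
  \<open>p m\<close> and \<open>q m\<close> exclude overflow.\<close>

lemma queue_run_control:
  fixes A :: "nat set" and w w' :: "nat set"
  defines "p \<equiv> \<lambda>j. card ({..<j} \<inter> A)" and "q \<equiv> \<lambda>j. card ({..<j} - A)"
  assumes a: "\<And>j. j < m \<Longrightarrow> \<nu> (2 * j + 1) = queue_control A j"
    and v: "\<And>j. j < m \<Longrightarrow> \<nu> (2 * j + 2) = (if j \<in> A then p j \<in> w else q j \<in> w')"
    and le: "p m \<le> k" "q m \<le> k" and "j \<le> m"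
  shows "queue_run k \<nu> j =
    (if \<forall>i<min (p j) (q j). i \<in> w \<longleftrightarrow> i \<in> w'
     then Some (map (\<lambda>i. i \<in> (if q j \<le> p j then w else w')) [min (p j) (q j)..<max (p j) (q j)])
     else None)"
  using \<open>j \<le> m\<close>
proof (induction j)
  case 0
  then show ?case by (simp add: p_def q_def)
next
  case (Suc j)
  have pS: "p (Suc j) = (if j \<in> A then Suc (p j) else p j)"
    and qS: "q (Suc j) = (if j \<in> A then q j else Suc (q j))"
    by (auto simp: p_def q_def lessThan_Suc insert_Diff_if)
  have mono: "p (Suc j) \<le> p m" "q (Suc j) \<le> q m"
    unfolding p_def q_def using Suc.prems by (auto intro!: card_mono)
  have a': "\<nu> (Suc (2 * j)) = (if j \<in> A then q j \<le> p j else p j \<le> q j)"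
    using a[of j] Suc.prems by (simp add: queue_control_def p_def q_def)
  have v': "\<nu> (Suc (Suc (2 * j))) = (if j \<in> A then p j \<in> w else q j \<in> w')"
    using v[of j] Suc.prems by simp
  have IH: "queue_run k \<nu> j =
    (if \<forall>i<min (p j) (q j). i \<in> w \<longleftrightarrow> i \<in> w'
     then Some (map (\<lambda>i. i \<in> (if q j \<le> p j then w else w')) [min (p j) (q j)..<max (p j) (q j)])
     else None)" using Suc by simp
  \<comment> \<open>In cases 1 and 3 the new value belongs to a side that is ahead or level and is
    appended; in cases 2 and 4 its side is behind and it is compared with the head.\<close>
  consider "j \<in> A" "q j \<le> p j" | "j \<in> A" "p j < q j" | "j \<notin> A" "p j \<le> q j" | "j \<notin> A" "q j < p j"
    by linarith
  then show ?case
  proof cases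
    case 1
    then show ?thesis using mono le unfolding queue_run.simps IH
      by (auto simp: a' v' pS qS min_def max_def)
  next
    case 2
    then have "min (p j) (q j) = p j" "max (p j) (q j) = q j"
      "min (p (Suc j)) (q (Suc j)) = Suc (p j)" "max (p (Suc j)) (q (Suc j)) = q j"
      by (simp_all add: pS qS)
    with 2 show ?thesis unfolding queue_run.simps IH
      by (auto simp: a' v' pS qS upt_conv_Cons less_Suc_eq)
  next
    case 3
    then show ?thesis using mono le unfolding queue_run.simps IH
      by (auto simp: a' v' pS qS min_def max_def)
  next
    case 4
    then have "min (p j) (q j) = q j" "max (p j) (q j) = p j"
      "min (p (Suc j)) (q (Suc j)) = Suc (q j)" "max (p (Suc j)) (q (Suc j)) = p j"
      by (simp_all add: pS qS)
    with 4 show ?thesis unfolding queue_run.simps IH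
      by (auto simp: a' v' pS qS upt_conv_Cons less_Suc_eq)
  qed
qed

lemma queue_function_not_NOBDD:
  assumes n: "4 * k \<le> n" and d: "d < 2 ^ k"
  shows "queue_function n k \<notin> NOBDD n d"
proof
  assume "queue_function n k \<in> NOBDD n d"
  from NOBDD_fooling_set[OF this, where 'w = "nat set"] obtain \<pi> where
    \<pi>: "\<pi> permutes {1..n}" and fool: "\<forall>l W (x :: nat set \<Rightarrow> nat \<Rightarrow> bool).
      l \<le> n \<longrightarrow> (\<forall>w\<in>W. x w \<in> inputs n) \<longrightarrow> (\<forall>w\<in>W. queue_function n k (x w)) \<longrightarrow>
      (\<forall>w\<in>W. \<forall>w'\<in>W. queue_function n k (override_on (x w') (x w) (\<pi> ` {1..l})) \<longrightarrow> w = w') \<longrightarrow>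
      card W \<le> d"
    by (elim exE conjE)
  obtain l where l: "l \<le> n" "card {j. j < 2 * k \<and> 2 * j + 2 \<in> \<pi> ` {1..l}} = k"
    using value_cut[OF \<pi>, of "2 * k" k] n by auto
  define V where "V = \<pi> ` {1..l}"
  define A where "A = {j. j < 2 * k \<and> 2 * j + 2 \<in> V}"
  have "{..<2 * k} \<inter> A = A" by (auto simp: A_def)
  then have pk: "card ({..<2 * k} \<inter> A) = k" using l(2) by (simp add: A_def V_def)
  then have qk: "card ({..<2 * k} - A) = k" by (simp add: card_Diff_subset_Int)
  \<comment> \<open>Both sides of the cut spell the same word \<open>w\<close>, so a mixed input
    compares the word of one input with that of the other.\<close>
  define x where "x w = pair_input n (queue_control A)
    (\<lambda>j. if j \<in> A then card ({..<j} \<inter> A) \<in> w else card ({..<j} - A) \<in> w)" for w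
  have eq: "queue_function n k (override_on (x w') (x w) V) \<longleftrightarrow> (\<forall>i<k. i \<in> w \<longleftrightarrow> i \<in> w')" for w w'
  proof -
    let ?x = "override_on (x w') (x w) V"
    have "?x \<in> inputs n" by (simp add: x_def override_on_inputs pair_input_inputs)
    have "?x (2 * j + 1) = queue_control A j" if "j < 2 * k" for j
      using that n by (simp add: x_def override_on_pair_input[of _ "2 * k"])
    moreover have "?x (2 * j + 2) =
        (if j \<in> A then card ({..<j} \<inter> A) \<in> w else card ({..<j} - A) \<in> w')" if "j < 2 * k" for j
    proof -
      have "j \<in> A \<longleftrightarrow> 2 * j + 2 \<in> V" using that by (simp add: A_def)
      then show ?thesis using that n by (simp add: x_def override_on_pair_input[of _ "2 * k"])
    qed
    ultimately have "queue_run k ?x (2 * k) = (if \<forall>i<k. i \<in> w \<longleftrightarrow> i \<in> w' then Some [] else None)"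
      using queue_run_control[of "2 * k" ?x A w w' k "2 * k"] pk qk by simp
    with \<open>?x \<in> inputs n\<close> show ?thesis by (simp add: queue_function_def)
  qed
  have self: "override_on (x w) (x w) V = x w" for w by (auto simp: override_on_def)
  have "card (Pow {..<k}) \<le> d"
  proof (rule fool[rule_format, OF l(1)])
    show "x w \<in> inputs n" for w by (simp add: x_def pair_input_inputs)
    show "queue_function n k (x w)" for w using eq[of w w] by (simp add: self)
    show "w = w'" if "w \<in> Pow {..<k}" "w' \<in> Pow {..<k}"
      "queue_function n k (override_on (x w') (x w) (\<pi> ` {1..l}))" for w w'
      using that eq[of w' w] by (auto simp: V_def)
  qed
  then show False using d by (simp add: card_Pow)
qed

section \<open>The pointer function\<close>

definition selected :: "bool \<Rightarrow> (nat \<Rightarrow> bool) \<Rightarrow> nat \<Rightarrow> bool list" where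
  "selected c \<nu> m = map (\<lambda>j. \<nu> (2 * j + 2)) (filter (\<lambda>j. \<nu> (2 * j + 1) = c) [0..<m])"

lemma selected_0: "selected c \<nu> 0 = []"
  by (simp add: selected_def)

lemma selected_Suc:
  "selected c \<nu> (Suc j) = selected c \<nu> j @ (if \<nu> (2 * j + 1) = c then [\<nu> (2 * j + 2)] else [])"
  by (simp add: selected_def)

text \<open>The number of earlier values of the same kind is the position that a value takes in its
  list, so a counter suffices to recognise it.\<close>

lemma selected_nth:
  assumes "j < m" "\<nu> (2 * j + 1) = c"
  shows "length (selected c \<nu> j) < length (selected c \<nu> m) \<and>
    selected c \<nu> m ! length (selected c \<nu> j) = \<nu> (2 * j + 2)"
proof -
  have "[0..<m] = [0..<j] @ [j..<m]"
    using assms(1) upt_add_eq_append[of 0 j "m - j"] by simp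
  also have "[j..<m] = j # [Suc j..<m]" using assms(1) by (rule upt_conv_Cons)
  finally have "selected c \<nu> m = selected c \<nu> j @ \<nu> (2 * j + 2) #
      map (\<lambda>j. \<nu> (2 * j + 2)) (filter (\<lambda>j. \<nu> (2 * j + 1) = c) [Suc j..<m])"
    using assms(2) by (simp add: selected_def)
  then show ?thesis by simp
qed

text \<open>The values with control bit \<open>1\<close> spell the binary representation of a position in the list
  of the values with control bit \<open>0\<close>; the function returns the value found there.\<close>

definition pointer_function :: "nat \<Rightarrow> nat \<Rightarrow> nat \<Rightarrow> (nat \<Rightarrow> bool) \<Rightarrow> bool" where
  "pointer_function n K L = restrict (\<lambda>\<nu>. \<exists>i<K.
     i < length (selected False \<nu> (K + L)) \<and> selected False \<nu> (K + L) ! i \<and>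
     L \<le> length (selected True \<nu> (K + L)) \<and> (\<forall>r<L. selected True \<nu> (K + L) ! r = bit i r)) (inputs n)"

lemma pointer_function_NOBDD:
  assumes n: "2 * (K + L) \<le> n" and d: "2 * (K * (K + 1) * (L + 1) + 1) \<le> d"
  shows "pointer_function n K L \<in> NOBDD n d"
proof -
  define m where "m = K + L"
  define Q where "Q = insert None (Some ` ({..<K} \<times> {..K} \<times> {..L}))"
  \<comment> \<open>A state \<open>Some (i, c, p)\<close> records the guessed position and how many values of either kind
    have been read; the guess is made in the first step.\<close>
  define R where "R s a v t \<longleftrightarrow> (\<exists>i c p. (s = Some (i, c, p) \<or> s = None \<and> i < K \<and> c = 0 \<and> p = 0) \<and>
      t = Some (i, if a then c else min K (Suc c), if a then min L (Suc p) else p) \<and>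
      (\<not> a \<and> c = i \<longrightarrow> v) \<and> (a \<and> p < L \<longrightarrow> v = bit i p))"
    for s t :: "(nat \<times> nat \<times> nat) option" and a v
  \<comment> \<open>The condition \<open>i < c\<close> certifies that the guessed position was read,
    hence tested to be 1; the counter \<open>L\<close> certifies that every pointer bit was compared
    with the guess.\<close>
  define F where "F = {Some (i, c, L) | i c :: nat. i < c}"
  have "\<exists>B :: nat bdd. nondeterministic_obdd n B \<and> width n B \<le> d \<and>
    computes n B (pointer_function n K L) \<and>
    ((\<forall>s\<in>Q. \<forall>a v. \<exists>!t. R s a v t) \<longrightarrow> deterministic_obdd n B)"
  proof (rule exists_obdd_of_pairs[where m = m and ?s0.0 = None and F = F])
    show "finite Q" by (simp add: Q_def)
    have "card Q = K * (K + 1) * (L + 1) + 1"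
      by (simp add: Q_def card_insert_if card_image card_cartesian_product image_iff algebra_simps)
    then show "2 * card Q \<le> d" using d by simp
    show "None \<in> Q" by (simp add: Q_def)
    show "t \<in> Q" if "s \<in> Q" "R s a v t" for s a v t
    proof -
      obtain i c p where *: "s = Some (i, c, p) \<or> s = None \<and> i < K \<and> c = 0 \<and> p = 0"
        "t = Some (i, if a then c else min K (Suc c), if a then min L (Suc p) else p)"
        using \<open>R s a v t\<close> unfolding R_def by blast
      then have "i < K" "c \<le> K" "p \<le> L" using \<open>s \<in> Q\<close> by (auto simp: Q_def)
      then show ?thesis using *(2) by (simp add: Q_def)
    qed
    show "2 * m \<le> n" using n by (simp add: m_def)
    fix \<nu> assume \<nu>: "\<nu> \<in> inputs n"
    let ?\<alpha> = "selected False \<nu>" and ?\<beta> = "selected True \<nu>"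
    have "pointer_function n K L \<nu> \<longleftrightarrow> (\<exists>i<K. i < length (?\<alpha> m) \<and> ?\<alpha> m ! i \<and>
        L \<le> length (?\<beta> m) \<and> (\<forall>r<L. ?\<beta> m ! r = bit i r))"
      using \<nu> by (simp add: pointer_function_def m_def)
    also have "\<dots> \<longleftrightarrow>
      (\<exists>q. q 0 = None \<and> (\<forall>j<m. R (q j) (\<nu> (2 * j + 1)) (\<nu> (2 * j + 2)) (q (Suc j))) \<and> q m \<in> F)"
    proof
      assume "\<exists>i<K. i < length (?\<alpha> m) \<and> ?\<alpha> m ! i \<and> L \<le> length (?\<beta> m) \<and> (\<forall>r<L. ?\<beta> m ! r = bit i r)"
      then obtain i where i: "i < K" "i < length (?\<alpha> m)" "?\<alpha> m ! i" "L \<le> length (?\<beta> m)"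
        "\<And>r. r < L \<Longrightarrow> ?\<beta> m ! r = bit i r" by blast
      define q where "q j = (if j = 0 then None
        else Some (i, min K (length (?\<alpha> j)), min L (length (?\<beta> j))))" for j :: nat
      have "R (q j) (\<nu> (2 * j + 1)) (\<nu> (2 * j + 2)) (q (Suc j))" if "j < m" for j
        unfolding R_def
      proof (intro exI conjI)
        show "q j = Some (i, min K (length (?\<alpha> j)), min L (length (?\<beta> j))) \<or>
          q j = None \<and> i < K \<and> min K (length (?\<alpha> j)) = 0 \<and> min L (length (?\<beta> j)) = 0"
          using i(1) by (auto simp: q_def selected_0)
        \<comment> \<open>Capping the counter at \<open>K\<close> does no harm: since
          \<open>i < K\<close>, the capped count equals \<open>i\<close> only when the true count
          does.\<close>
        show "\<not> \<nu> (2 * j + 1) \<and> min K (length (?\<alpha> j)) = i \<longrightarrow> \<nu> (2 * j + 2)"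
          using selected_nth[OF that, of \<nu> False] i by (auto simp: min_def split: if_splits)
        show "\<nu> (2 * j + 1) \<and> min L (length (?\<beta> j)) < L \<longrightarrow>
          \<nu> (2 * j + 2) = bit i (min L (length (?\<beta> j)))"
          using selected_nth[OF that, of \<nu> True] i(5)[of "length (?\<beta> j)"] by (auto simp: min_def)
      qed (auto simp: q_def selected_Suc)
      moreover have "q m \<in> F" using i by (simp add: q_def F_def m_def)
      ultimately show "\<exists>q. q 0 = None \<and>
          (\<forall>j<m. R (q j) (\<nu> (2 * j + 1)) (\<nu> (2 * j + 2)) (q (Suc j))) \<and> q m \<in> F"
        by (intro exI[of _ q]) (simp add: q_def)
    next
      assume "\<exists>q. q 0 = None \<and>
          (\<forall>j<m. R (q j) (\<nu> (2 * j + 1)) (\<nu> (2 * j + 2)) (q (Suc j))) \<and> q m \<in> F"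
      then obtain q where q: "q 0 = None" "q m \<in> F"
        "\<And>j. j < m \<Longrightarrow> R (q j) (\<nu> (2 * j + 1)) (\<nu> (2 * j + 2)) (q (Suc j))" by blast
      have "m \<noteq> 0" using q(1,2) by (cases m) (auto simp: F_def)
      then obtain i c0 p0 where i: "i < K" "q 1 = Some (i, c0, p0)"
        using q(3)[of 0] q(1) by (auto simp: R_def)
      \<comment> \<open>The guess never changes after the first step, and every tested bit agrees
        with it. Time 0 is excepted because no guess has been made in the state
        \<open>None\<close>.\<close>
      have inv: "(j = 0 \<or> q j = Some (i, min K (length (?\<alpha> j)), min L (length (?\<beta> j)))) \<and>
          (i < length (?\<alpha> j) \<longrightarrow> ?\<alpha> j ! i) \<and>
          (\<forall>r<min L (length (?\<beta> j)). ?\<beta> j ! r = bit i r)" if "j \<le> m" for j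
        using that
      proof (induction j)
        case 0
        then show ?case by (simp add: selected_0)
      next
        case (Suc j)
        let ?c = "min K (length (?\<alpha> j))" and ?p = "min L (length (?\<beta> j))"
        obtain i' c p where *: "q j = Some (i', c, p) \<or> q j = None \<and> i' < K \<and> c = 0 \<and> p = 0"
          "q (Suc j) = Some (i', if \<nu> (2 * j + 1) then c else min K (Suc c),
             if \<nu> (2 * j + 1) then min L (Suc p) else p)"
          "\<not> \<nu> (2 * j + 1) \<and> c = i' \<longrightarrow> \<nu> (2 * j + 2)"
          "\<nu> (2 * j + 1) \<and> p < L \<longrightarrow> \<nu> (2 * j + 2) = bit i' p"
          using q(3)[of j, unfolded R_def] Suc.prems by (auto simp del: One_nat_def)
        have cp: "i' = i \<and> c = ?c \<and> p = ?p"
        proof (cases "j = 0")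
          case True
          then show ?thesis using * q(1) i(2) by (simp add: selected_0)
        next
          case False
          then show ?thesis using * Suc by auto
        qed
        have IH: "i < length (?\<alpha> j) \<longrightarrow> ?\<alpha> j ! i" "\<forall>r<?p. ?\<beta> j ! r = bit i r"
          using Suc by auto
        show ?case
        proof (intro conjI)
          show "Suc j = 0 \<or> q (Suc j) = Some (i, min K (length (?\<alpha> (Suc j))), min L (length (?\<beta> (Suc j))))"
            using *(2) cp by (auto simp: selected_Suc)
          show "i < length (?\<alpha> (Suc j)) \<longrightarrow> ?\<alpha> (Suc j) ! i"
            using *(3) cp IH(1) i(1) by (auto simp: selected_Suc nth_append less_Suc_eq)
          show "\<forall>r<min L (length (?\<beta> (Suc j))). ?\<beta> (Suc j) ! r = bit i r"
            using *(4) cp IH(2) by (auto simp: selected_Suc nth_append less_Suc_eq)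
        qed
      qed
      from inv[of m] \<open>m \<noteq> 0\<close> q(2) have "i < length (?\<alpha> m)" "?\<alpha> m ! i" "L \<le> length (?\<beta> m)"
        by (auto simp: F_def)
      with inv[of m] i(1) show "\<exists>i<K. i < length (?\<alpha> m) \<and> ?\<alpha> m ! i \<and> L \<le> length (?\<beta> m) \<and>
        (\<forall>r<L. ?\<beta> m ! r = bit i r)" by (intro exI[of _ i]) simp
    qed
    finally show "pointer_function n K L \<nu> \<longleftrightarrow>
      (\<exists>q. q 0 = None \<and> (\<forall>j<m. R (q j) (\<nu> (2 * j + 1)) (\<nu> (2 * j + 2)) (q (Suc j))) \<and> q m \<in> F)" .
  qed
  then show ?thesis
    unfolding NOBDD_def by (auto simp: boolean_functions_def pointer_function_def)
qed

section \<open>Lower bound for the pointer function\<close>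

lemma nat_eq_of_low_bits:
  fixes i i' :: nat
  assumes "i < 2 ^ L" "i' < 2 ^ L" "\<And>r. r < L \<Longrightarrow> bit i r = bit i' r"
  shows "i = i'"
proof -
  have "take_bit L i = take_bit L i'" by (rule bit_eqI) (auto simp: bit_take_bit_iff assms(3))
  then show ?thesis using assms(1,2) by (simp add: take_bit_nat_eq_self)
qed

text \<open>The \<open>K\<close> values read before the cut are declared data and the other
  \<open>L\<close> the pointer. Two different data strings differ at some position, and the unread
  values can point to it.\<close>

lemma pointer_function_not_OBDD:
  assumes n: "2 * (K + L) \<le> n" and L: "K \<le> 2 ^ L" and d: "d < 2 ^ K"
  shows "pointer_function n K L \<notin> OBDD n d"
proof
  assume "pointer_function n K L \<in> OBDD n d"
  from OBDD_subfunctions[OF this, where 'w = "nat set"] obtain \<pi> where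
    \<pi>: "\<pi> permutes {1..n}" and sub: "\<forall>l W (x :: nat set \<Rightarrow> nat \<Rightarrow> bool).
      l \<le> n \<longrightarrow> (\<forall>w\<in>W. x w \<in> inputs n) \<longrightarrow>
      (\<forall>w\<in>W. \<forall>w'\<in>W. w \<noteq> w' \<longrightarrow> (\<exists>y\<in>inputs n.
         pointer_function n K L (override_on y (x w) (\<pi> ` {1..l})) \<noteq>
         pointer_function n K L (override_on y (x w') (\<pi> ` {1..l})))) \<longrightarrow>
      card W \<le> d"
    by (elim exE conjE)
  define m where "m = K + L"
  obtain l where l: "l \<le> n" "card {j. j < m \<and> 2 * j + 2 \<in> \<pi> ` {1..l}} = K"
    using value_cut[OF \<pi>, of m K] n by (auto simp: m_def)
  define V where "V = \<pi> ` {1..l}"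
  define A where "A = {j. j < m \<and> 2 * j + 2 \<in> V}"
  have cardA: "card A = K" using l(2) by (simp add: A_def V_def)
  have AV: "j \<in> A \<longleftrightarrow> 2 * j + 2 \<in> V" if "j < m" for j using that by (simp add: A_def)
  define al where "al = filter (\<lambda>j. j \<in> A) [0..<m]"
  define bl where "bl = filter (\<lambda>j. j \<notin> A) [0..<m]"
  have al: "set al = A" "distinct al" by (auto simp: al_def A_def)
  then have lal: "length al = K" using cardA distinct_card by metis
  have bl: "distinct bl" by (simp add: bl_def)
  have lbl: "length bl = L"
    using sum_length_filter_compl[of "\<lambda>j. j \<in> A" "[0..<m]"] lal by (simp add: al_def bl_def m_def)
  \<comment> \<open>The values \<open>z i\<close> spell the bits of \<open>i\<close> along the
    unread pairs: the inverse of indexing gives the rank of \<open>j\<close> in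
    \<open>bl\<close>.\<close>
  define z where "z i j = bit i (the_inv_into {..<L} ((!) bl) j)" for i j :: nat
  have z: "z i (bl ! r) = bit i r" if "r < L" for i r
    unfolding z_def using that bl lbl by (subst the_inv_into_f_f) (auto simp: inj_on_def nth_eq_iff_index_eq)
  define x where "x S = pair_input n (\<lambda>j. j \<notin> A) (\<lambda>j. j \<in> S)" for S
  define y where "y i = pair_input n (\<lambda>j. j \<notin> A) (z i)" for i
  have eval: "pointer_function n K L (override_on (y i) (x S) V) \<longleftrightarrow> al ! i \<in> S" if i: "i < K" for i S
  proof -
    let ?x = "override_on (y i) (x S) V"
    have a: "?x (2 * j + 1) \<longleftrightarrow> j \<notin> A" and v: "?x (2 * j + 2) \<longleftrightarrow> (if j \<in> A then j \<in> S else z i j)"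
      if "j < m" for j
      using that n AV[OF that] by (simp_all add: x_def y_def override_on_pair_input[of _ m] m_def)
    have "filter (\<lambda>j. ?x (2 * j + 1) = False) [0..<m] = al"
      "filter (\<lambda>j. ?x (2 * j + 1) = True) [0..<m] = bl"
      unfolding al_def bl_def using a by (auto intro!: filter_cong)
    then have "selected False ?x m = map (\<lambda>j. j \<in> S) al" "selected True ?x m = map (z i) bl"
      using v by (auto simp: selected_def al_def bl_def)
    then have "pointer_function n K L ?x \<longleftrightarrow> (\<exists>i'<K. al ! i' \<in> S \<and> (\<forall>r<L. bit i r = bit i' r))"
      by (simp add: pointer_function_def lal lbl z x_def y_def override_on_inputs pair_input_inputs
          flip: m_def cong: conj_cong)
    \<comment> \<open>By \<open>K \<le> 2 ^ L\<close>, positions below \<open>K\<close> are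
      determined by their low \<open>L\<close> bits, so \<open>i\<close> is the only position
      selected.\<close>
    also have "\<dots> \<longleftrightarrow> al ! i \<in> S"
      using nat_eq_of_low_bits[of i L] i L by (metis order_less_le_trans)
    finally show ?thesis .
  qed
  have "card (Pow A) \<le> d"
  proof (rule sub[rule_format, OF l(1)])
    show "x S \<in> inputs n" for S by (simp add: x_def pair_input_inputs)
    fix S S' assume "S \<in> Pow A" "S' \<in> Pow A" "S \<noteq> S'"
    then obtain j where "j \<in> A" "j \<in> S \<longleftrightarrow> j \<notin> S'" by blast
    then obtain i where "i < K" "al ! i \<in> S \<longleftrightarrow> al ! i \<notin> S'"
      using al(1) lal by (metis in_set_conv_nth)
    then show "\<exists>y \<in> inputs n. pointer_function n K L (override_on y (x S) (\<pi> ` {1..l})) \<noteq>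
        pointer_function n K L (override_on y (x S') (\<pi> ` {1..l}))"
      using eval by (intro bexI[of _ "y i"]) (auto simp: V_def y_def pair_input_inputs)
  qed
  moreover have "finite A" by (simp add: A_def)
  ultimately show False using d by (simp add: card_Pow cardA)
qed

section \<open>The subset construction\<close>

text \<open>Determinization by tracking the set of nodes reachable on the bits read: a level with at
  most \<open>w\<close> nodes has at most \<open>2 ^ w\<close> subsets.\<close>

lemma NOBDD_subset_OBDD:
  assumes "2 ^ w \<le> d"
  shows "NOBDD n w \<subseteq> OBDD n d"
proof
  fix f assume "f \<in> NOBDD n w"
  then obtain B :: "nat bdd" where f: "f \<in> boolean_functions n"
    and B: "nondeterministic_obdd n B" "width n B \<le> w" "computes n B f"
    by (auto simp: NOBDD_def)
  have l0: "level B 0 = {source B}" and fin: "\<And>j. j \<le> n \<Longrightarrow> finite (level B j)"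
    and perm: "var_order B permutes {1..n}"
    using B(1) by (simp_all add: nondeterministic_obdd_def)
  define \<delta> where "\<delta> j S b = {v. \<exists>u\<in>S. (u, b, v) \<in> edges B}" for j :: nat and S b
  define Q where "Q j = (if j = 0 then {{source B}} else Pow (level B j))" for j
  have Qsub: "S \<subseteq> level B j" if "S \<in> Q j" for S j
    using that l0 by (auto simp: Q_def split: if_splits)
  show "f \<in> OBDD n d"
  proof (rule OBDD_I[where Q = Q and \<delta> = \<delta> and \<pi> = "var_order B" and ?s0.0 = "{source B}"
        and F = "{S. S \<inter> accepting B \<noteq> {}}"])
    show "finite (Q j)" if "j \<le> n" for j using fin[OF that] by (simp add: Q_def)
    show "card (Q j) \<le> d" if "j \<le> n" for j
    proof -
      have "card (level B j) \<le> w" using card_level_le_width[OF that, of B] B(2) by simp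
      then have "(2::nat) ^ card (level B j) \<le> d"
        using assms by (meson one_le_numeral order_trans power_increasing)
      moreover have "1 \<le> d" using assms by (metis one_le_numeral one_le_power order_trans)
      ultimately show ?thesis using fin[OF that] by (simp add: Q_def card_Pow)
    qed
    show "\<delta> j S b \<in> Q (Suc j)" if "j < n" "S \<in> Q j" for j S b
      using edge_level[OF B(1) that(1)] Qsub[OF that(2)] by (auto simp: Q_def \<delta>_def)
    fix \<nu> assume "\<nu> \<in> inputs n"
    define p where "p = rec_nat {source B} (\<lambda>j S. \<delta> j S (\<nu> (var_order B (Suc j))))"
    have p: "p 0 = {source B}" "p (Suc j) = \<delta> j (p j) (\<nu> (var_order B (Suc j)))" for j
      by (simp_all add: p_def)
    \<comment> \<open>The witnesses \<open>q\<close> are total functions constrained only on the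
      first \<open>j\<close> steps, so a path is extended by changing one value.\<close>
    have reach: "v \<in> p j \<longleftrightarrow> (\<exists>q. q 0 = source B \<and>
        (\<forall>i<j. (q i, \<nu> (var_order B (Suc i)), q (Suc i)) \<in> edges B) \<and> q j = v)" for j v
    proof (induction j arbitrary: v)
      case 0
      then show ?case by (auto simp: p)
    next
      case (Suc j)
      show ?case
      proof
        assume "v \<in> p (Suc j)"
        then obtain u where u: "u \<in> p j" "(u, \<nu> (var_order B (Suc j)), v) \<in> edges B"
          by (auto simp: p \<delta>_def)
        then obtain q where "q 0 = source B" "q j = u"
          "\<forall>i<j. (q i, \<nu> (var_order B (Suc i)), q (Suc i)) \<in> edges B" using Suc by blast
        with u show "\<exists>q. q 0 = source B \<and>
          (\<forall>i<Suc j. (q i, \<nu> (var_order B (Suc i)), q (Suc i)) \<in> edges B) \<and> q (Suc j) = v"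
          by (intro exI[of _ "q(Suc j := v)"]) (auto simp: less_Suc_eq)
      next
        assume "\<exists>q. q 0 = source B \<and>
          (\<forall>i<Suc j. (q i, \<nu> (var_order B (Suc i)), q (Suc i)) \<in> edges B) \<and> q (Suc j) = v"
        then obtain q where "q 0 = source B" "q (Suc j) = v"
          "\<forall>i<Suc j. (q i, \<nu> (var_order B (Suc i)), q (Suc i)) \<in> edges B" by blast
        moreover from this have "q j \<in> p j" using Suc[of "q j"] by auto
        ultimately show "v \<in> p (Suc j)" unfolding p \<delta>_def by blast
      qed
    qed
    have "obdd_output n B \<nu> \<longleftrightarrow> p n \<inter> accepting B \<noteq> {}"
    proof
      assume "obdd_output n B \<nu>"
      then obtain q where q: "consistent_path n B \<nu> q" "q n \<in> accepting B"
        by (auto simp: obdd_output_def)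
      then have "q n \<in> p n" unfolding reach
        using consistent_path_edge[OF q(1)] by (intro exI[of _ q]) (simp add: consistent_path_def)
      with q show "p n \<inter> accepting B \<noteq> {}" by blast
    next
      assume "p n \<inter> accepting B \<noteq> {}"
      then obtain v where v: "v \<in> p n" "v \<in> accepting B" by blast
      from v(1)[unfolded reach] obtain q where "q 0 = source B" "q n = v"
        "\<forall>i<n. (q i, \<nu> (var_order B (Suc i)), q (Suc i)) \<in> edges B" by blast
      with v(2) have q: "q 0 = source B" "q n \<in> accepting B"
        "\<And>i. i < n \<Longrightarrow> (q i, \<nu> (var_order B (Suc i)), q (Suc i)) \<in> edges B" by simp_all
      have "consistent_path n B \<nu> (restrict q {0..n})"
        unfolding consistent_path_def
      proof (intro conjI ballI)
        fix j assume "j \<in> {1..n}"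
        then show "(restrict q {0..n} (j - 1), \<nu> (var_order B j), restrict q {0..n} j) \<in> edges B"
          using q(3)[of "j - 1"] by auto
      qed (simp_all add: q)
      then show "obdd_output n B \<nu>"
        unfolding obdd_output_def using q(2) by (intro exI[of _ "restrict q {0..n}"]) simp
    qed
    then have "f \<nu> \<longleftrightarrow> p n \<inter> accepting B \<noteq> {}"
      using B(3) \<open>\<nu> \<in> inputs n\<close> by (simp add: computes_def)
    then show "\<exists>p. p 0 = {source B} \<and> (\<forall>j<n. p (Suc j) = \<delta> j (p j) (\<nu> (var_order B (Suc j)))) \<and>
      (f \<nu> \<longleftrightarrow> p n \<in> {S. S \<inter> accepting B \<noteq> {}})"
      using p by (intro exI[of _ p]) simp
  qed (use f perm in \<open>simp_all add: Q_def\<close>)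
qed

section \<open>The separation\<close>

lemma exists_log_bounds:
  fixes d :: nat
  assumes "1 \<le> d"
  obtains k where "2 ^ k \<le> d" "d < 2 ^ Suc k"
  using ex_power_ivl1[of 2 d] assms by auto

lemma powr_le_of_power_le:
  assumes "2 ^ e \<le> d"
  shows "2 powr real e \<le> real d"
proof -
  have "real (2 ^ e) \<le> real d" using assms by (simp only: of_nat_le_iff)
  then show ?thesis by (simp add: powr_realpow)
qed

text \<open>The queue has capacity \<open>k\<close>, two less than the rounded-down logarithm of
  \<open>d\<close>. Then \<open>2 ^ (k + 2) \<le> d\<close> gives the upper bound, while
  \<open>d < 2 ^ (k + 3)\<close> turns \<open>d' < d / 8\<close> into
  \<open>d' < 2 ^ k\<close>.\<close>

lemma OBDD_not_subset_NOBDD: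
  fixes n d d' :: nat
  assumes d: "real d \<le> 2 powr (real n / 4)" and d': "real d' < real d / 8" and "4 \<le> d"
  shows "\<not> OBDD n d \<subseteq> NOBDD n d'"
proof -
  obtain e where e: "2 ^ e \<le> d" "d < 2 ^ Suc e" using exists_log_bounds[of d] \<open>4 \<le> d\<close> by auto
  have "2 \<le> e"
  proof (rule ccontr)
    assume "\<not> 2 \<le> e"
    then have "(2::nat) ^ Suc e \<le> 2 ^ 2" by (intro power_increasing) auto
    with e \<open>4 \<le> d\<close> show False by simp
  qed
  then obtain k where k: "e = k + 2" by (metis add.commute le_iff_add)
  have "2 powr real e \<le> real d" using e(1) by (rule powr_le_of_power_le)
  also note d
  finally have "real e \<le> real n / 4" by simp
  then have n: "4 * k \<le> n" using k by linarith
  have "8 * d' < d" using d' by linarith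
  then have "d' < 2 ^ k" using e(2) by (simp add: k)
  then show ?thesis
    using queue_function_OBDD[OF n] queue_function_not_NOBDD[OF n] e(1) k by blast
qed

text \<open>\<open>K\<close> is least with \<open>d < 2 ^ K\<close> and \<open>L\<close> is least
  with \<open>K < 2 ^ L\<close>. The pointer program then has width of order
  \<open>x\<^sup>2 * log 2 x\<close>, well within the assumed bound.\<close>

lemma NOBDD_not_subset_OBDD:
  fixes n d d' :: nat
  defines "x \<equiv> log 2 (real d + 1)"
  assumes d: "real d \<le> 2 powr (real n / 4)" and d': "50 * (x ^ 4 * log 2 x) < real d'" and "16 \<le> d"
  shows "\<not> NOBDD n d' \<subseteq> OBDD n d"
proof -
  obtain e where e: "2 ^ e \<le> d" "d < 2 ^ Suc e" using exists_log_bounds[of d] \<open>16 \<le> d\<close> by auto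
  define K where "K = Suc e"
  obtain L' where L': "2 ^ L' \<le> K" "K < 2 ^ Suc L'" using exists_log_bounds[of K] by (auto simp: K_def)
  define L where "L = Suc L'"
  have "4 \<le> e"
  proof (rule ccontr)
    assume "\<not> 4 \<le> e"
    then have "(2::nat) ^ Suc e \<le> 2 ^ 4" by (intro power_increasing) auto
    with e \<open>16 \<le> d\<close> show False by simp
  qed
  have ed: "2 powr real e \<le> real d" using e(1) by (rule powr_le_of_power_le)
  also note d
  finally have en: "real e \<le> real n / 4" by simp
  \<comment> \<open>This gives \<open>K + L \<le> 2 * e\<close>, hence
    \<open>2 * (K + L) \<le> 4 * e \<le> n\<close>. It holds because
    \<open>e + 1 < 2 ^ (e - 1)\<close> from \<open>e = 4\<close> on.\<close>
  have "L' + 2 \<le> e"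
  proof (rule ccontr)
    assume "\<not> L' + 2 \<le> e"
    then have "(2::nat) ^ (e - 1) \<le> 2 ^ L'" by (intro power_increasing) auto
    then have "(2::nat) ^ (e - 1) \<le> Suc e" using L'(1) unfolding K_def by (rule order_trans)
    moreover obtain i where "e = i + 4" using \<open>4 \<le> e\<close> by (metis add.commute le_iff_add)
    moreover have "i + 5 < 8 * 2 ^ i" by (induction i) auto
    ultimately show False by (simp add: power_add)
  qed
  then have n: "2 * (K + L) \<le> n" using en by (simp add: K_def L_def)
  have xe: "real e \<le> x" 
  proof -
    have "real e = log 2 (2 powr real e)" by simp
    also have "\<dots> \<le> x" unfolding x_def using ed by (subst log_le_cancel_iff) auto
    finally show ?thesis .
  qed
  then have x4: "4 \<le> x" using \<open>4 \<le> e\<close> by linarith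
  have K: "real K \<le> 2 * x" using xe x4 by (simp add: K_def)
  have y1: "1 \<le> log 2 x" using x4 by (simp add: le_log_iff)
  have "real L' \<le> log 2 x + 1"
  proof -
    have "2 powr real L' \<le> real K" using L'(1) by (rule powr_le_of_power_le)
    then have "(2::real) powr real L' \<le> 2 * x" using K by linarith
    then have "real L' \<le> log 2 (2 * x)" using x4 by (simp add: le_log_iff)
    then show ?thesis using x4 by (simp add: log_mult)
  qed
  then have L4: "real L + 1 \<le> 4 * log 2 x" using y1 by (simp add: L_def)
  have "real (2 * (K * (K + 1) * (L + 1) + 1)) = 2 * (real K * (real K + 1) * (real L + 1)) + 2"
    by (simp add: algebra_simps)
  \<comment> \<open>The constant 50 arises here: doubling 2 * 3 * 4 gives 48, and the additive 2 is
    absorbed by \<open>2 * (x\<^sup>2 * log 2 x)\<close>.\<close>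
  also have "real K * (real K + 1) * (real L + 1) \<le> (2 * x) * (3 * x) * (4 * log 2 x)"
    using K L4 x4 y1 by (intro mult_mono) auto
  finally have "real (2 * (K * (K + 1) * (L + 1) + 1)) \<le> 48 * (x\<^sup>2 * log 2 x) + 2"
    by (simp add: power2_eq_square)
  moreover have "1 * 1 \<le> x\<^sup>2 * log 2 x" using x4 y1 by (intro mult_mono) (auto simp: one_le_power)
  moreover have "x\<^sup>2 * log 2 x \<le> x ^ 4 * log 2 x"
    using x4 y1 by (intro mult_right_mono power_increasing) auto
  ultimately have "real (2 * (K * (K + 1) * (L + 1) + 1)) < real d'" using d' by linarith
  then have "pointer_function n K L \<in> NOBDD n d'"
    using n by (intro pointer_function_NOBDD) (simp_all only: of_nat_less_iff)
  moreover have "pointer_function n K L \<notin> OBDD n d"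
    using n L'(2) e(2) by (intro pointer_function_not_OBDD) (simp_all add: K_def L_def)
  ultimately show ?thesis by blast
qed

theorem theorem10:
  "\<exists>g :: nat \<Rightarrow> real.
     g \<in> O(\<lambda>d. (log 2 (real d + 1)) ^ 4 * log 2 (log 2 (real d + 1))) \<and>
     (\<forall>n d d' :: nat.
        real d \<le> 2 powr (real n / 4) \<and> g d < real d' \<and> real d' < real d / 8 - 1 \<longrightarrow>
          NOBDD n (nat \<lfloor>log 2 (real d)\<rfloor>) \<subset> OBDD n d \<and>
          (\<not> OBDD n d \<subseteq> NOBDD n d' \<and> \<not> NOBDD n d' \<subseteq> OBDD n d))"
proof (intro exI conjI allI impI)
  let ?g = "\<lambda>d::nat. 50 * ((log 2 (real d + 1)) ^ 4 * log 2 (log 2 (real d + 1)))"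
  show "?g \<in> O(\<lambda>d. (log 2 (real d + 1)) ^ 4 * log 2 (log 2 (real d + 1)))" by simp
  fix n d d' :: nat
  assume h: "real d \<le> 2 powr (real n / 4) \<and> ?g d < real d' \<and> real d' < real d / 8 - 1"
  define x where "x = log 2 (real d + 1)"
  \<comment> \<open>A bootstrap: \<open>d' \<ge> 0\<close> forces \<open>d > 8\<close>, hence
    \<open>x \<ge> 2\<close> and a nonnegative iterated logarithm. Then
    \<open>d' > x \<ge> 2\<close>, which in turn makes \<open>d\<close> exceed 16.\<close>
  have "8 < d" using h by linarith
  then have x: "2 \<le> x" by (simp add: x_def le_log_iff)
  then have y: "1 \<le> log 2 x" by (simp add: le_log_iff)
  have "x ^ 1 * 1 \<le> x ^ 4 * log 2 x" using x y by (intro mult_mono power_increasing) auto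
  then have xd: "x < real d'" using h x by (simp add: x_def)
  then have "16 \<le> d" using h x by linarith
  show A: "\<not> OBDD n d \<subseteq> NOBDD n d'" using h \<open>16 \<le> d\<close> by (intro OBDD_not_subset_NOBDD) auto
  show "\<not> NOBDD n d' \<subseteq> OBDD n d" using h \<open>16 \<le> d\<close> by (intro NOBDD_not_subset_OBDD) auto
  define w where "w = nat \<lfloor>log 2 (real d)\<rfloor>"
  have lw: "real w \<le> log 2 (real d)" using \<open>16 \<le> d\<close> by (simp add: w_def)
  then have "(2::real) powr real w \<le> real d" using \<open>16 \<le> d\<close> by (simp add: le_log_iff)
  then have "real (2 ^ w) \<le> real d" by (simp add: powr_realpow)
  then have "NOBDD n w \<subseteq> OBDD n d" by (intro NOBDD_subset_OBDD) (simp only: of_nat_le_iff)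
  \<comment> \<open>For strictness: \<open>w \<le> d'\<close> places \<open>NOBDD n w\<close> inside
    \<open>NOBDD n d'\<close>, which misses some function of \<open>OBDD n d\<close> by the first
    separation.\<close>
  moreover have "log 2 (real d) \<le> x" using \<open>16 \<le> d\<close> by (simp add: x_def)
  then have "w \<le> d'" using lw xd by linarith
  then have "NOBDD n w \<subseteq> NOBDD n d'" by (rule NOBDD_mono)
  ultimately show "NOBDD n (nat \<lfloor>log 2 (real d)\<rfloor>) \<subset> OBDD n d"
    using A unfolding w_def by blast
qed

end
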